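(* Suppose that each $f_i:\mathbb{R}^n\to\mathbb{R}$, $i=1,\dots,N$, is continuously differentiable with $L$-Lipschitz continuous gradient and bounded from below by a constant $f_{low}$, and that there exists a constant $C_b$ such that $\mathbb{E}(|f(x_{\tilde k})|)\le C_b$, where $\tilde k$ is the finite random iteration index specified in the context. Then almost surely every accumulation point of the sequence $\{x_k\}_{k\in\mathbb{N}}$ generated by the AS-BOX algorithm is a stationary point of the problem $\min_{x\in S} f(x)$.
   Context: Problem. $f(x)=\sum_{i=1}^N w_i f_i(x)$ with $w_i\ge 0$, $\sum_{i=1}^N w_i=1$, and $S=\{x\in\mathbb{R}^n : l_i\le x_i\le u_i,\ i=1,\dots,n\}$ (nonempty), $l_i\in\mathbb{R}\cup\{-\infty\}$, $u_i\in\mathbb{R}\cup\{\infty\}$. $\pi_S$ is the orthogonal projection onto $S$, $\|\cdot\|$ the Euclidean norm, $[v]_i$ the $i$-th component of $v$, and $d(x):=\pi_S(x-\nabla f(x))-x$. A point $x\in S$ is stationary for $\min_{x\in S}f(x)$ if $\nabla f(x)^T(y-x)\ge 0$ for all $y\in S$ (equivalently $d(x)=0$). Samples. For a finite sample (tuple, repetitions allowed) $\mathcal{N}_k=\{i^k_1,\dots,i^k_{N_k}\}$ of indices from $\{1,\dots,N\}$, of size $N_k$, $f_{\mathcal{N}_k}(x)=\frac1{N_k}\sum_{i\in\mathcal{N}_k}f_i(x)$ (counted with repetition). If $N_k<N$, each $i^k_j$ equals $s$ with probability $w_s$, independent draws; if $N_k=N$, one sets $f_{\mathcal{N}_k}=f$.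 The additional sample $\mathcal{D}_k=\{l^k_1,\dots,l^k_{D_k}\}$ of size $D_k$, with $1\le D_k\le N-1$, is drawn independently of $\mathcal{N}_k$ and of the past, each $l^k_j$ independently equal to $s$ with probability $w_s$, and $f_{\mathcal{D}_k}(x)=\frac1{D_k}\sum_{i\in\mathcal{D}_k}f_i(x)$. Indicator vectors. $[\tilde I_{\mathcal{N}_k}]_i$ equals $1$ if $[x_k]_i-[\nabla f_{\mathcal{N}_k}(x_k)]_i<l_i$; $2$ if $l_i\le [x_k]_i-[\nabla f_{\mathcal{N}_k}(x_k)]_i\le u_i$; $3$ if $[x_k]_i-[\nabla f_{\mathcal{N}_k}(x_k)]_i>u_i$. $\tilde I_{\mathcal{D}_k}$ is defined in the same way with $f_{\mathcal{D}_k}$ in place of $f_{\mathcal{N}_k}$, and $\tilde r_{\mathcal{D}_k}=\|\tilde I_{\mathcal{N}_k}-\tilde I_{\mathcal{D}_k}\|$. AS-BOX algorithm. Input: $x_0\in S$, $N_0\in\{1,\dots,N\}$, $\beta,c,c_1\in(0,1)$, $C>0$, a deterministic sequence $\varepsilon_k>0$ with $\sum_{k=0}^\infty\varepsilon_k\le\bar\varepsilon<\infty$. For $k=0,1,2,\dots$: (S1) If $N_k<N$ draw $\mathcal{N}_k=\{i^k_1,\dots,i^k_{N_k}\}$ by independent draws, each $i^k_j$ being equal to $s$ with probability $w_s$, $s=1,\dots,N$; else $f_{\mathcal{N}_k}=f$. (S2) $p_k=\pi_S(x_k-\nabla f_{\mathcal{N}_k}(x_k))-x_k$. (S3) Find the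 smallest $j\in\{0,1,2,\dots\}$ such that $t_k=\beta^j$ satisfies $f_{\mathcal{N}_k}(x_k+t_kp_k)\le f_{\mathcal{N}_k}(x_k)+c_1t_k\nabla f_{\mathcal{N}_k}(x_k)^Tp_k+\varepsilon_k$; set $\bar x_k=x_k+t_kp_k$. (S4) If $N_k=N$, set $x_{k+1}=\bar x_k$, $N_{k+1}=N$ and go to the next iteration. Else draw $\mathcal{D}_k$ and compute $s_k=\pi_S(x_k-\nabla f_{\mathcal{D}_k}(x_k))-x_k$ and $\tilde r_{\mathcal{D}_k}$. (S5) If $\tilde r_{\mathcal{D}_k}=0$ and $f_{\mathcal{D}_k}(\bar x_k)\le f_{\mathcal{D}_k}(x_k)-c\|s_k\|^2+C\varepsilon_k$, set $N_{k+1}=N_k$; else choose (arbitrarily) $N_{k+1}\in\{N_k+1,\dots,N\}$. (S6) If $f_{\mathcal{D}_k}(\bar x_k)\le f_{\mathcal{D}_k}(x_k)-c\|s_k\|^2+C\varepsilon_k$, set $x_{k+1}=\bar x_k$; else $x_{k+1}=x_k$. The index $\tilde k$. Let $\mathcal{D}_k^-$ be the set of possible outcomes of $\mathcal{D}_k$ at iteration $k$ for which $\tilde r_{\mathcal{D}_k}>0$ or $f_{\mathcal{D}_k}(\bar x_k)>f_{\mathcal{D}_k}(x_k)-c\|s_k\|^2+C\varepsilon_k$. On sample paths where $N_k=N$ for some $k$ (FS scenario), $\tilde k=\tilde k_1$ is the first iteration with $N_k=N$. On sample paths where $N_k<N$ for all $k$ (MB scenario), $\tilde k=k_1$ is a finite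 random iteration such that $\mathcal{D}_k^-=\emptyset$ for all $k\ge k_1$ (such an iteration exists almost surely). *)

theory Defs
  imports "HOL-Probability.Probability"
begin

definition box_set :: "('n::finite \<Rightarrow> ereal) \<Rightarrow> ('n \<Rightarrow> ereal) \<Rightarrow> (real^'n) set" where
  "box_set l u = {y. \<forall>i. l i \<le> ereal (y $ i) \<and> ereal (y $ i) \<le> u i}"

definition grad :: "('v::real_inner \<Rightarrow> real) \<Rightarrow> 'v \<Rightarrow> 'v" where
  "grad h y = (THE D. GDERIV h y :> D)"

definition stationary_point :: "('v::real_inner \<Rightarrow> real) \<Rightarrow> 'v set \<Rightarrow> 'v \<Rightarrow> bool" where
  "stationary_point h S z \<longleftrightarrow> z \<in> S \<and> (\<forall>y\<in>S. grad h z \<bullet> (y - z) \<ge> 0)"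

text \<open>A sample is the list of its indices, so repetitions count.\<close>

definition sample_avg :: "(nat \<Rightarrow> 'v \<Rightarrow> real) \<Rightarrow> nat list \<Rightarrow> 'v \<Rightarrow> real" where
  "sample_avg fi J y = (\<Sum>i\<leftarrow>J. fi i y) / real (length J)"

text \<open>The projected gradient direction: \<^term>\<open>closest_point S\<close> is the orthogonal projection onto
  the closed convex set \<^term>\<open>S\<close>.\<close>

definition proj_dir :: "'v::euclidean_space set \<Rightarrow> ('v \<Rightarrow> real) \<Rightarrow> 'v \<Rightarrow> 'v" where
  "proj_dir S h y = closest_point S (y - grad h y) - y"

definition box_indicator ::
    "('n::finite \<Rightarrow> ereal) \<Rightarrow> ('n \<Rightarrow> ereal) \<Rightarrow> (real^'n \<Rightarrow> real) \<Rightarrow> real^'n \<Rightarrow> real^'n" where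
  "box_indicator l u h y =
     (\<chi> i. if ereal (y $ i - grad h y $ i) < l i then 1
           else if ereal (y $ i - grad h y $ i) \<le> u i then 2 else 3)"

text \<open>Nonmonotone Armijo backtracking along the direction \<^term>\<open>p\<close> with relaxation \<^term>\<open>e\<close>.
  The minimum is attained whenever \<^term>\<open>e > 0\<close>, \<^term>\<open>0 < \<beta>\<close>, \<^term>\<open>\<beta> < 1\<close> and \<^term>\<open>h\<close> is
  continuous at \<^term>\<open>y\<close>.\<close>

definition line_search ::
    "real \<Rightarrow> real \<Rightarrow> real \<Rightarrow> ('v::real_inner \<Rightarrow> real) \<Rightarrow> 'v \<Rightarrow> 'v \<Rightarrow> 'v" where
  "line_search \<beta> c1 e h y p =
     y + \<beta> ^ (LEAST j::nat. h (y + \<beta> ^ j *\<^sub>R p) \<le> h y + c1 * \<beta> ^ j * (grad h y \<bullet> p) + e) *\<^sub>R p"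

text \<open>On the event \<^term>\<open>E\<close>, the random tuple \<^term>\<open>T\<close> has the (random) length \<^term>\<open>m\<close>, and,
  conditionally on the information \<^term>\<open>H\<close> available before the draw, which determines
  \<^term>\<open>E\<close> and \<^term>\<open>m\<close>, its entries are independent and each equals \<^term>\<open>s\<close> with probability
  \<^term>\<open>w s\<close> (\<^term>\<open>s \<in> {1..N}\<close>).  The conditional law of the discrete variable \<^term>\<open>T\<close> is written
  in its elementary form, tested against the events of \<^term>\<open>H\<close>.  For deterministic \<^term>\<open>m\<close> and
  \<^term>\<open>E = space M\<close>, this says that \<^term>\<open>T\<close> is independent of \<^term>\<open>H\<close> and is
  distributed as \<^term>\<open>m\<close> independent draws from \<^term>\<open>w\<close>.\<close>

definition iid_draws ::
    "'a measure \<Rightarrow> 'a measure \<Rightarrow> nat \<Rightarrow> (nat \<Rightarrow> real) \<Rightarrow> 'a set \<Rightarrow> ('a \<Rightarrow> nat) \<Rightarrow> ('a \<Rightarrow> nat list) \<Rightarrow> bool"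
  where
  "iid_draws M H N w E m T \<longleftrightarrow>
     E \<in> sets H \<and> m \<in> measurable H (count_space UNIV) \<and> T \<in> measurable M (count_space UNIV) \<and>
     (\<forall>\<omega>\<in>E. length (T \<omega>) = m \<omega> \<and> set (T \<omega>) \<subseteq> {1..N}) \<and>
     (\<forall>A\<in>sets H. \<forall>J. set J \<subseteq> {1..N} \<longrightarrow>
        measure M {\<omega> \<in> A \<inter> E. m \<omega> = length J \<and> T \<omega> = J} =
        measure M {\<omega> \<in> A \<inter> E. m \<omega> = length J} * (\<Prod>s\<leftarrow>J. w s))"

end

theory Submission
  imports Defs
begin

text \<open>The sizes \<open>N\<^sub>k\<close> never decrease and never exceed \<open>N\<close>, so every sample path either reaches the
  full sample or has an eventually constant size below \<open>N\<close>.  In both cases a sufficient decrease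
  inequality forces projected gradient directions to tend to zero, and continuity turns this into
  stationarity of the accumulation points (\<open>stationary_accumulation_point\<close>).

  On a path that reaches the full sample, the tail is a deterministic projected gradient method for
  \<open>f\<close> with a relaxed Armijo rule.  As \<open>grad f\<close> is Lipschitz, the step lengths stay away from zero
  (\<open>line_search_decrease\<close>), so the sum of all \<open>\<parallel>d(x\<^sub>k)\<parallel>\<^sup>2\<close> on the tail is finite.

  On a path of constant size below \<open>N\<close>, consider for an index \<open>s\<close> with \<open>w\<^sub>s > 0\<close> the constant
  additional sample \<open>(s, \<dots>, s)\<close>, whose average is just \<open>f\<^sub>s\<close>.  It is drawn with conditional
  probability at least \<open>w\<^sub>s\<^sup>N\<close>, and if it violates the decrease test when drawn, then the
  size grows.  A bounded counter grows boundedly often, so the probabilities that \<open>(s, \<dots>, s)\<close>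
  would violate the test at iteration \<open>k\<close> are summable, and by the Borel-Cantelli lemma almost surely
  it violates the test only finitely often.  From then on
  \<open>f\<^sub>s(x\<^sub>k\<^sub>+\<^sub>1) \<le> f\<^sub>s(x\<^sub>k) - c \<parallel>d\<^sub>s(x\<^sub>k)\<parallel>\<^sup>2 + C \<epsilon>\<^sub>k\<close> for each such \<open>s\<close> separately, where \<open>d\<^sub>s\<close> is the
  projected gradient direction of \<open>f\<^sub>s\<close>.  Hence an accumulation point is stationary for every
  \<open>f\<^sub>s\<close> of positive weight, and therefore for \<open>f\<close>.\<close>

section \<open>Gradients\<close>

lemma GDERIV_unique:
  assumes "GDERIV h y :> D" "GDERIV h y :> D'"
  shows "D = D'"
proof -
  have "(\<lambda>v. v \<bullet> D) = (\<lambda>v. v \<bullet> D')"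
    using assms unfolding gderiv_def by (rule has_derivative_unique)
  then have "v \<bullet> D = v \<bullet> D'" for v
    by metis
  then have "v \<bullet> (D - D') = 0" for v
    by (simp add: inner_diff_right)
  then show ?thesis
    by (metis inner_eq_zero_iff right_minus_eq)
qed

lemma grad_eqI: "GDERIV h y :> D \<Longrightarrow> grad h y = D"
  unfolding grad_def by (blast intro: the_equality GDERIV_unique)

lemma differentiable_imp_GDERIV_grad:
  fixes h :: "'v::euclidean_space \<Rightarrow> real"
  assumes "h differentiable (at y)"
  shows "GDERIV h y :> grad h y"
proof -
  obtain h' where h': "(h has_derivative h') (at y)"
    using assms unfolding differentiable_def by blast
  then have "linear h'"
    by (rule has_derivative_linear)
  then have "h' = (\<lambda>v. v \<bullet> adjoint h' 1)"
    using adjoint_works[of h' _ 1] by (simp add: fun_eq_iff)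
  with h' have "GDERIV h y :> adjoint h' 1"
    unfolding gderiv_def by simp
  with grad_eqI show ?thesis
    by metis
qed

lemma GDERIV_weighted_sum:
  fixes g :: "'i \<Rightarrow> 'v::euclidean_space \<Rightarrow> real"
  assumes "\<And>i. i \<in> I \<Longrightarrow> g i differentiable (at y)"
  shows "GDERIV (\<lambda>y. \<Sum>i\<in>I. w i * g i y) y :> (\<Sum>i\<in>I. w i *\<^sub>R grad (g i) y)"
  unfolding gderiv_def inner_sum_right inner_scaleR_right
  by (intro has_derivative_sum has_derivative_mult_right)
    (use differentiable_imp_GDERIV_grad assms in \<open>auto simp: gderiv_def\<close>)

section \<open>Projected gradient directions\<close>

lemma closed_box_set: "closed (box_set l u)"
proof -
  have "box_set l u = (\<Inter>i. (\<lambda>y. ereal (y $ i)) -` {l i..u i})"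
    by (auto simp: box_set_def)
  then show ?thesis
    by (auto intro!: closed_INT closed_vimage continuous_intros)
qed

lemma convex_box_set: "convex (box_set l u)"
proof -
  have "convex {r. a \<le> ereal r \<and> ereal r \<le> b}" for a b
    unfolding is_interval_convex_1[symmetric] is_interval_1
    by auto (meson ereal_less_eq(3) order_trans)+
  then have "convex ((\<lambda>y. y $ i) -` {r. l i \<le> ereal r \<and> ereal r \<le> u i})" for i
    by (intro convex_linear_vimage bounded_linear.linear bounded_linear_vec_nth)
  moreover have "box_set l u = (\<Inter>i. (\<lambda>y. y $ i) -` {r. l i \<le> ereal r \<and> ereal r \<le> u i})"
    by (auto simp: box_set_def)
  ultimately show ?thesis
    by (simp add: convex_INT)
qed

text \<open>Obtuse angle criterion for the projection of \<^term>\<open>y - grad h y\<close>, tested at \<^term>\<open>y\<close> itself: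
  the projected gradient direction is a descent direction of slope at most \<open>- \<parallel>p\<parallel>\<^sup>2\<close>.\<close>

lemma grad_inner_proj_dir_le:
  assumes "closed S" "convex S" "y \<in> S"
  shows "grad h y \<bullet> proj_dir S h y \<le> - (norm (proj_dir S h y))\<^sup>2"
proof -
  define p where "p = proj_dir S h y"
  have "closest_point S (y - grad h y) = y + p"
    by (simp add: p_def proj_dir_def)
  then have "(- grad h y - p) \<bullet> (- p) \<le> 0"
    using closest_point_dot[OF assms(2,1,3), of "y - grad h y"] by simp
  then show ?thesis
    by (simp add: p_def[symmetric] inner_diff_left power2_norm_eq_inner)
qed

lemma proj_dir_eq_0_imp_stationary:
  assumes "closed S" "convex S" "S \<noteq> {}" "proj_dir S h z = 0"
  shows "stationary_point h S z"
proof -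
  have z: "closest_point S (z - grad h z) = z"
    using assms(4) by (simp add: proj_dir_def)
  have "z \<in> S"
    using closest_point_in_set[OF assms(1,3), of "z - grad h z"] z by simp
  moreover have "grad h z \<bullet> (y - z) \<ge> 0" if "y \<in> S" for y
    using closest_point_dot[OF assms(2,1) that, of "z - grad h z"] z by simp
  ultimately show ?thesis
    by (simp add: stationary_point_def)
qed

lemma stationary_accumulation_point:
  assumes "closed S" "convex S" "S \<noteq> {}" "continuous_on UNIV (grad h)"
    and "(\<lambda>k. proj_dir S h (y k)) \<longlonglongrightarrow> 0" "strict_mono r" "(\<lambda>j. y (r j)) \<longlonglongrightarrow> z"
  shows "stationary_point h S z"
proof -
  have cont: "continuous_on UNIV (\<lambda>v. proj_dir S h v)"
    unfolding proj_dir_def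
    by (intro continuous_intros assms(4)
        continuous_on_compose2[OF continuous_on_closest_point[OF assms(2,1,3), of UNIV]]) auto
  have "(\<lambda>j. proj_dir S h (y (r j))) \<longlonglongrightarrow> proj_dir S h z"
    using continuous_on_tendsto_compose[OF cont assms(7)] by simp
  moreover have "(\<lambda>j. proj_dir S h (y (r j))) \<longlonglongrightarrow> 0"
    using LIMSEQ_subseq_LIMSEQ[OF assms(5,6)] by (simp add: o_def)
  ultimately have "proj_dir S h z = 0"
    by (rule LIMSEQ_unique)
  with assms show ?thesis
    by (intro proj_dir_eq_0_imp_stationary)
qed

text \<open>The variational inequality is linear in the gradient, and summands of weight zero do not
  contribute to the gradient of the weighted sum.\<close>

lemma stationary_point_weighted_sum:
  fixes g :: "'i \<Rightarrow> 'v::euclidean_space \<Rightarrow> real"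
  assumes "\<And>i. i \<in> I \<Longrightarrow> g i differentiable (at z)" "\<And>i. i \<in> I \<Longrightarrow> 0 \<le> w i" "z \<in> S"
    and stat: "\<And>i. i \<in> I \<Longrightarrow> 0 < w i \<Longrightarrow> stationary_point (g i) S z"
  shows "stationary_point (\<lambda>y. \<Sum>i\<in>I. w i * g i y) S z"
proof -
  have "0 \<le> (\<Sum>i\<in>I. w i *\<^sub>R grad (g i) z) \<bullet> (y - z)" if "y \<in> S" for y
    unfolding inner_sum_left inner_scaleR_left
  proof (rule sum_nonneg)
    fix i assume "i \<in> I"
    then show "0 \<le> w i * (grad (g i) z \<bullet> (y - z))"
      using stat[of i] assms(2)[of i] that
      by (cases "w i = 0") (auto simp: stationary_point_def)
  qed
  then show ?thesis
    using assms(3) grad_eqI[OF GDERIV_weighted_sum[of I g z w]] assms(1)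
    by (simp add: stationary_point_def)
qed

section \<open>Sufficient decrease and the line search\<close>

text \<open>Telescoping bounds the partial sums of \<open>\<kappa> \<parallel>p k\<parallel>\<^sup>2\<close> by the total decrease still possible plus the
  total relaxation.\<close>

lemma sufficient_decrease_tendsto_0:
  fixes a e :: "nat \<Rightarrow> real" and p :: "nat \<Rightarrow> 'v::real_normed_vector"
  assumes decrease: "\<And>k. K \<le> k \<Longrightarrow> a (Suc k) \<le> a k - \<kappa> * (norm (p k))\<^sup>2 + e k"
    and "0 < \<kappa>" and e: "\<And>k. 0 \<le> e k" "summable e" and bounded: "\<And>k. B \<le> a k"
  shows "p \<longlonglongrightarrow> 0"
proof -
  define b where "b k = \<kappa> * (norm (p k))\<^sup>2" for k
  have "(\<Sum>i<n. b (i + K)) \<le> a K - a (n + K) + (\<Sum>i<n. e (i + K))" for n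
  proof (induction n)
    case (Suc n)
    then show ?case
      using decrease[of "n + K"] by (simp add: b_def)
  qed simp
  moreover have "(\<Sum>i<n. e (i + K)) \<le> (\<Sum>i. e (i + K))" for n
    using e by (intro sum_le_suminf) (auto simp: summable_iff_shift)
  ultimately have "(\<Sum>i<n. b (i + K)) \<le> a K - B + (\<Sum>i. e (i + K))" for n
    using bounded[of "n + K"] by (meson add_mono diff_left_mono order_trans)
  then have "summable (\<lambda>i. b (i + K))"
    using \<open>0 < \<kappa>\<close> by (intro summableI_nonneg_bounded) (auto simp: b_def)
  then have "b \<longlonglongrightarrow> 0"
    by (simp add: summable_iff_shift summable_LIMSEQ_zero)
  then have "(\<lambda>k. b k / \<kappa>) \<longlonglongrightarrow> 0 / \<kappa>"
    using \<open>0 < \<kappa>\<close> by (intro tendsto_divide tendsto_const) auto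
  then have "(\<lambda>k. (norm (p k))\<^sup>2) \<longlonglongrightarrow> 0"
    using \<open>0 < \<kappa>\<close> by (simp add: b_def)
  then have "(\<lambda>k. sqrt ((norm (p k))\<^sup>2)) \<longlonglongrightarrow> sqrt 0"
    by (rule tendsto_real_sqrt)
  then show ?thesis
    by (simp add: tendsto_norm_zero_iff)
qed

lemma line_search_in_convex:
  assumes "closed S" "convex S" "y \<in> S" "0 < \<beta>" "\<beta> < 1"
  shows "line_search \<beta> c1 e h y (proj_dir S h' y) \<in> S"
proof -
  have "(1 - \<beta> ^ j) *\<^sub>R y + \<beta> ^ j *\<^sub>R closest_point S (y - grad h' y) \<in> S" for j
    using assms closest_point_in_set[of S] by (intro convexD) (auto intro: power_le_one)
  then show ?thesis
    by (simp add: line_search_def proj_dir_def algebra_simps)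
qed

text \<open>The mean value theorem gives the descent lemma with \<open>L\<close> in place of the optimal constant
  \<open>L / 2\<close>.  The constant only affects the lower bound on the step lengths.\<close>

lemma lipschitz_grad_increment_le:
  fixes h :: "'v::euclidean_space \<Rightarrow> real"
  assumes diff: "\<And>y. h differentiable (at y)" and lip: "L-lipschitz_on UNIV (grad h)" and "0 < t"
  shows "h (y + t *\<^sub>R p) \<le> h y + t * (grad h y \<bullet> p) + L * t\<^sup>2 * (norm p)\<^sup>2"
proof -
  have deriv: "((\<lambda>s. h (y + s *\<^sub>R p)) has_derivative (\<lambda>r. (r *\<^sub>R p) \<bullet> grad h (y + s *\<^sub>R p)))
      (at s within {0..t})" for s
  proof -
    have "(h has_derivative (\<lambda>v. v \<bullet> grad h (y + s *\<^sub>R p))) (at (y + s *\<^sub>R p))"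
      using differentiable_imp_GDERIV_grad[OF diff] by (simp add: gderiv_def)
    moreover have "((\<lambda>s. y + s *\<^sub>R p) has_derivative (\<lambda>r. r *\<^sub>R p)) (at s within {0..t})"
      by (auto intro!: derivative_eq_intros)
    ultimately show ?thesis
      by (rule has_derivative_compose[rotated])
  qed
  obtain s where s: "0 < s" "s < t"
    and mean: "h (y + t *\<^sub>R p) - h y = (t *\<^sub>R p) \<bullet> grad h (y + s *\<^sub>R p)"
    using mvt_simple[OF \<open>0 < t\<close> deriv] by auto
  have "p \<bullet> (grad h (y + s *\<^sub>R p) - grad h y) \<le> norm p * norm (grad h (y + s *\<^sub>R p) - grad h y)"
    by (rule norm_cauchy_schwarz)
  also have "\<dots> \<le> norm p * (L * (s * norm p))"
    using lipschitz_onD[OF lip, of "y + s *\<^sub>R p" y] s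
    by (intro mult_left_mono) (auto simp: dist_norm)
  also have "\<dots> \<le> norm p * (L * (t * norm p))"
    using s lipschitz_on_nonneg[OF lip] by (intro mult_left_mono mult_right_mono) auto
  finally have "t * (p \<bullet> (grad h (y + s *\<^sub>R p) - grad h y)) \<le> t * (norm p * (L * (t * norm p)))"
    using \<open>0 < t\<close> by (intro mult_left_mono) auto
  then show ?thesis
    using mean by (simp add: inner_diff_right inner_commute power2_eq_square algebra_simps)
qed

text \<open>The step lengths chosen by backtracking stay above a positive constant: along the projected
  gradient direction the Armijo condition with slope \<open>c1\<close> holds as soon as
  \<open>L t \<le> 1 - c1\<close>, by the quadratic bound for functions with Lipschitz gradient.  Hence every
  line search decreases the function by a fixed multiple of \<open>\<parallel>p\<parallel>\<^sup>2\<close>, up to the relaxation.\<close>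

lemma line_search_decrease:
  fixes h :: "'v::euclidean_space \<Rightarrow> real"
  assumes diff: "\<And>y. h differentiable (at y)" and lip: "L-lipschitz_on UNIV (grad h)"
    and S: "closed S" "convex S" and \<beta>: "0 < \<beta>" "\<beta> < 1" and c1: "0 < c1" "c1 < 1"
  obtains \<kappa> where "0 < \<kappa>"
    and "\<And>y e. \<lbrakk>y \<in> S; 0 < e\<rbrakk> \<Longrightarrow>
      h (line_search \<beta> c1 e h y (proj_dir S h y)) \<le> h y - \<kappa> * (norm (proj_dir S h y))\<^sup>2 + e"
proof -
  have L: "0 \<le> L"
    using lip by (rule lipschitz_on_nonneg)
  \<comment> \<open>\<open>L + 1\<close> avoids a division by zero for \<open>L = 0\<close>.\<close>
  obtain m where m: "\<beta> ^ m < (1 - c1) / (L + 1)"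
    using real_arch_pow_inv[of "(1 - c1) / (L + 1)" \<beta>] \<beta> c1 L by auto
  have "\<beta> ^ m * L \<le> \<beta> ^ m * (L + 1)"
    using \<beta> by (intro mult_left_mono) auto
  also have "\<dots> \<le> 1 - c1"
    using m L by (simp add: pos_less_divide_eq)
  finally have mL: "\<beta> ^ m * L \<le> 1 - c1" .
  have "h (line_search \<beta> c1 e h y (proj_dir S h y))
      \<le> h y - (c1 * \<beta> ^ m) * (norm (proj_dir S h y))\<^sup>2 + e" if "y \<in> S" "0 < e" for y e
  proof -
    define p where "p = proj_dir S h y"
    define armijo where "armijo j \<longleftrightarrow> h (y + \<beta> ^ j *\<^sub>R p) \<le> h y + c1 * \<beta> ^ j * (grad h y \<bullet> p) + e" for j
    have slope: "grad h y \<bullet> p \<le> - (norm p)\<^sup>2"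
      using grad_inner_proj_dir_le[OF S \<open>y \<in> S\<close>] by (simp add: p_def)
    have "L * (\<beta> ^ m)\<^sup>2 * (norm p)\<^sup>2 = \<beta> ^ m * (\<beta> ^ m * L * (norm p)\<^sup>2)"
      by (simp add: power2_eq_square algebra_simps)
    also have "\<dots> \<le> \<beta> ^ m * ((1 - c1) * (norm p)\<^sup>2)"
      using \<beta> mL by (intro mult_left_mono mult_right_mono) auto
    also have "\<dots> \<le> \<beta> ^ m * ((1 - c1) * - (grad h y \<bullet> p))"
      using \<beta> c1 slope by (intro mult_left_mono) auto
    finally have "armijo m"
      using lipschitz_grad_increment_le[OF diff lip, of "\<beta> ^ m" y p] \<beta> \<open>0 < e\<close>
      by (simp add: armijo_def algebra_simps)
    define j where "j = (LEAST j. armijo j)"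
    have "armijo j" "j \<le> m"
      using \<open>armijo m\<close> by (auto simp: j_def intro: LeastI Least_le)
    have "c1 * \<beta> ^ j * (grad h y \<bullet> p) \<le> c1 * \<beta> ^ j * - (norm p)\<^sup>2"
      using slope \<beta> c1 by (intro mult_left_mono) auto
    moreover have "c1 * \<beta> ^ m * (norm p)\<^sup>2 \<le> c1 * \<beta> ^ j * (norm p)\<^sup>2"
      using \<beta> c1 \<open>j \<le> m\<close> by (intro mult_left_mono mult_right_mono power_decreasing) auto
    moreover have "line_search \<beta> c1 e h y p = y + \<beta> ^ j *\<^sub>R p"
      by (simp add: line_search_def j_def armijo_def)
    ultimately show ?thesis
      using \<open>armijo j\<close> by (simp add: armijo_def p_def[symmetric])
  qed
  with that[of "c1 * \<beta> ^ m"] \<beta> c1 show thesis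
    by simp
qed

lemma line_search_proj_dir_tendsto_0:
  fixes h :: "'v::euclidean_space \<Rightarrow> real"
  assumes "\<And>y. h differentiable (at y)" "L-lipschitz_on UNIV (grad h)"
    and "closed S" "convex S" "0 < \<beta>" "\<beta> < 1" "0 < c1" "c1 < 1"
    and below: "\<And>y. B \<le> h y"
    and e: "\<And>k. 0 < e k" "summable e"
    and in_S: "\<And>k. y k \<in> S"
    and step: "\<And>k. K \<le> k \<Longrightarrow> y (Suc k) = line_search \<beta> c1 (e k) h (y k) (proj_dir S h (y k))"
  shows "(\<lambda>k. proj_dir S h (y k)) \<longlonglongrightarrow> 0"
proof -
  obtain \<kappa> where \<kappa>: "0 < \<kappa>" and decrease: "\<And>y e. \<lbrakk>y \<in> S; 0 < e\<rbrakk> \<Longrightarrow>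
      h (line_search \<beta> c1 e h y (proj_dir S h y)) \<le> h y - \<kappa> * (norm (proj_dir S h y))\<^sup>2 + e"
    using line_search_decrease[OF assms(1-8)] by blast
  show ?thesis
  proof (rule sufficient_decrease_tendsto_0[where a = "\<lambda>k. h (y k)" and e = e and K = K and B = B])
    show "h (y (Suc k)) \<le> h (y k) - \<kappa> * (norm (proj_dir S h (y k)))\<^sup>2 + e k" if "K \<le> k" for k
      using decrease[OF in_S e(1)] step[OF that] by metis
  qed (use \<kappa> e below in \<open>auto intro: less_imp_le\<close>)
qed

section \<open>Functions of countable information\<close>

text \<open>All randomness of the algorithm comes from discrete draws, so each of its quantities factors
  through a measurable \<^typ>\<open>nat\<close>-valued code of the history.  An arbitrary function of such a code is
  measurable, so events that involve projections and line searches need no regularity of these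
  operations.\<close>

definition factors_through_code :: "'a measure \<Rightarrow> ('a \<Rightarrow> 'b) \<Rightarrow> bool" where
  "factors_through_code H g \<longleftrightarrow>
     (\<exists>code \<phi>. code \<in> measurable H (count_space (UNIV :: nat set)) \<and> (\<forall>\<omega>\<in>space H. g \<omega> = \<phi> (code \<omega>)))"

lemma factors_through_code_const: "(\<And>\<omega>. \<omega> \<in> space H \<Longrightarrow> g \<omega> = a) \<Longrightarrow> factors_through_code H g"
  unfolding factors_through_code_def
  by (intro exI[of _ "\<lambda>_. 0"] exI[of _ "\<lambda>_. a"]) auto

lemma factors_through_code_countable:
  fixes g :: "'a \<Rightarrow> 'b::countable"
  assumes "g \<in> measurable H (count_space UNIV)"
  shows "factors_through_code H g"
proof -
  have "(\<lambda>\<omega>. to_nat (g \<omega>)) \<in> measurable H (count_space UNIV)"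
    using assms by measurable
  then show ?thesis
    unfolding factors_through_code_def
    by (intro exI[of _ "\<lambda>\<omega>. to_nat (g \<omega>)"] exI[of _ from_nat]) auto
qed

lemma factors_through_code_Pair:
  assumes "factors_through_code H g" "factors_through_code H h"
  shows "factors_through_code H (\<lambda>\<omega>. (g \<omega>, h \<omega>))"
proof -
  obtain a \<phi> where a: "a \<in> measurable H (count_space (UNIV :: nat set))"
    "\<forall>\<omega>\<in>space H. g \<omega> = \<phi> (a \<omega>)"
    using assms(1) unfolding factors_through_code_def by blast
  obtain b \<psi> where b: "b \<in> measurable H (count_space (UNIV :: nat set))"
    "\<forall>\<omega>\<in>space H. h \<omega> = \<psi> (b \<omega>)"
    using assms(2) unfolding factors_through_code_def by blast
  have "(\<lambda>\<omega>. prod_encode (a \<omega>, b \<omega>)) \<in> measurable H (count_space UNIV)"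
    using a(1) b(1) by measurable
  then show ?thesis
    unfolding factors_through_code_def
    using a(2) b(2)
    by (intro exI[of _ "\<lambda>\<omega>. prod_encode (a \<omega>, b \<omega>)"]
        exI[of _ "\<lambda>n. (\<phi> (fst (prod_decode n)), \<psi> (snd (prod_decode n)))"]) auto
qed

lemma factors_through_code_map:
  assumes "factors_through_code H g" "\<And>\<omega>. \<omega> \<in> space H \<Longrightarrow> h \<omega> = \<psi> (g \<omega>)"
  shows "factors_through_code H h"
proof -
  obtain a \<phi> where a: "a \<in> measurable H (count_space (UNIV :: nat set))"
    "\<forall>\<omega>\<in>space H. g \<omega> = \<phi> (a \<omega>)"
    using assms(1) unfolding factors_through_code_def by blast
  then show ?thesis
    unfolding factors_through_code_def using assms(2)
    by (intro exI[of _ a] exI[of _ "\<lambda>n. \<psi> (\<phi> n)"]) auto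
qed

lemma factors_through_code_mono:
  assumes "factors_through_code H g" "subalgebra H' H"
  shows "factors_through_code H' g"
  using assms measurable_from_subalg[OF assms(2)]
  unfolding factors_through_code_def subalgebra_def by metis

lemma factors_through_code_event:
  assumes "factors_through_code H g"
  shows "{\<omega> \<in> space H. P (g \<omega>)} \<in> sets H"
proof -
  obtain a \<phi> where a: "a \<in> measurable H (count_space (UNIV :: nat set))"
    "\<forall>\<omega>\<in>space H. g \<omega> = \<phi> (a \<omega>)"
    using assms(1) unfolding factors_through_code_def by blast
  have "a -` {n. P (\<phi> n)} \<inter> space H \<in> sets H"
    using a(1) by (rule measurable_sets) simp
  moreover have "a -` {n. P (\<phi> n)} \<inter> space H = {\<omega> \<in> space H. P (g \<omega>)}"
    using a(2) by auto
  ultimately show ?thesis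
    by simp
qed

lemma nat_less_event:
  fixes m n :: "'a \<Rightarrow> nat"
  assumes "m \<in> measurable H (count_space UNIV)" "n \<in> measurable H (count_space UNIV)"
  shows "{\<omega> \<in> space H. m \<omega> < n \<omega>} \<in> sets H"
  using factors_through_code_event[OF factors_through_code_Pair[OF
        factors_through_code_countable[OF assms(1)] factors_through_code_countable[OF assms(2)]],
      of "\<lambda>(i, j). i < j"]
  by simp

section \<open>Random samples and bounded counters\<close>

lemma sample_avg_replicate: "0 < d \<Longrightarrow> sample_avg g (replicate d s) = g s"
  by (rule ext) (simp add: sample_avg_def sum_list_replicate)

text \<open>Given the past and the size \<open>d \<le> n\<close>, the constant sample has conditional probability
  \<open>w s ^ d \<ge> w s ^ n\<close>; summing over the values of the size gives the bound.\<close>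

lemma iid_draws_constant_sample:
  assumes "prob_space M" "subalgebra M H" "iid_draws M H N w E m T"
    and A: "A \<in> sets H" "A \<subseteq> E" and s: "s \<in> {1..N}" "0 \<le> w s" "w s \<le> 1"
    and m: "\<And>\<omega>. \<omega> \<in> E \<Longrightarrow> m \<omega> \<le> n"
  shows "measure M A * w s ^ n \<le> measure M {\<omega> \<in> A. T \<omega> = replicate (m \<omega>) s}"
proof -
  interpret prob_space M by fact
  have meas: "m \<in> measurable M (count_space UNIV)" "T \<in> measurable M (count_space UNIV)" "A \<in> sets M"
    using assms(2,3) A measurable_from_subalg[OF assms(2)]
    unfolding iid_draws_def subalgebra_def by auto
  have AM: "A \<subseteq> space M"
    using meas(3) sets.sets_into_space by auto
  have AE: "A \<inter> E = A"
    using A by auto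
  have sets1: "{\<omega> \<in> A. m \<omega> = d} \<in> sets M" for d
  proof -
    have "A \<inter> (m -` {d} \<inter> space M) \<in> sets M"
      using meas by (intro sets.Int measurable_sets[OF meas(1)]) auto
    moreover have "A \<inter> (m -` {d} \<inter> space M) = {\<omega> \<in> A. m \<omega> = d}"
      using AM by auto
    ultimately show ?thesis by simp
  qed
  have sets2: "{\<omega> \<in> A. m \<omega> = d \<and> T \<omega> = J} \<in> sets M" for d J
  proof -
    have "{\<omega> \<in> A. m \<omega> = d} \<inter> (T -` {J} \<inter> space M) \<in> sets M"
      using sets1 by (intro sets.Int measurable_sets[OF meas(2)]) auto
    moreover have "{\<omega> \<in> A. m \<omega> = d} \<inter> (T -` {J} \<inter> space M) = {\<omega> \<in> A. m \<omega> = d \<and> T \<omega> = J}"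
      using AM by auto
    ultimately show ?thesis by simp
  qed
  have "A = (\<Union>d\<in>{..n}. {\<omega> \<in> A. m \<omega> = d})"
    using m A by auto
  then have "measure M A = (\<Sum>d\<le>n. measure M {\<omega> \<in> A. m \<omega> = d})"
    using sets1 finite_measure_finite_Union[of "{..n}" "\<lambda>d. {\<omega> \<in> A. m \<omega> = d}"]
    by (auto simp: disjoint_family_on_def)
  then have "measure M A * w s ^ n = (\<Sum>d\<le>n. measure M {\<omega> \<in> A. m \<omega> = d} * w s ^ n)"
    by (simp add: sum_distrib_right)
  also have "\<dots> \<le> (\<Sum>d\<le>n. measure M {\<omega> \<in> A. m \<omega> = d} * w s ^ d)"
    using s by (intro sum_mono mult_left_mono power_decreasing) auto
  also have "\<dots> = (\<Sum>d\<le>n. measure M {\<omega> \<in> A. m \<omega> = d \<and> T \<omega> = replicate d s})"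
  proof (rule sum.cong)
    fix d
    have "set (replicate d s) \<subseteq> {1..N}"
      using s by (auto simp: set_replicate_conv_if)
    with assms(3) A(1) have "measure M {\<omega> \<in> A \<inter> E. m \<omega> = length (replicate d s) \<and> T \<omega> = replicate d s}
        = measure M {\<omega> \<in> A \<inter> E. m \<omega> = length (replicate d s)} * (\<Prod>s\<leftarrow>replicate d s. w s)"
      unfolding iid_draws_def by blast
    then show "measure M {\<omega> \<in> A. m \<omega> = d} * w s ^ d
        = measure M {\<omega> \<in> A. m \<omega> = d \<and> T \<omega> = replicate d s}"
      by (simp add: AE)
  qed simp
  also have "\<dots> = measure M (\<Union>d\<in>{..n}. {\<omega> \<in> A. m \<omega> = d \<and> T \<omega> = replicate d s})"
    using sets2 by (intro finite_measure_finite_Union[symmetric]) (auto simp: disjoint_family_on_def)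
  also have "(\<Union>d\<in>{..n}. {\<omega> \<in> A. m \<omega> = d \<and> T \<omega> = replicate d s})
      = {\<omega> \<in> A. T \<omega> = replicate (m \<omega>) s}"
    using m A by auto
  finally show ?thesis .
qed

text \<open>The partial sums are expected numbers of increases.  Each increase adds at least 1 to the
  counter, so there are at most \<open>b\<close> of them on every path.\<close>

lemma summable_prob_counter_increases:
  fixes n :: "nat \<Rightarrow> 'a \<Rightarrow> nat"
  assumes "prob_space M" and meas: "\<And>k. n k \<in> measurable M (count_space UNIV)"
    and mono: "\<And>k \<omega>. \<omega> \<in> space M \<Longrightarrow> n k \<omega> \<le> n (Suc k) \<omega>"
    and bound: "\<And>k \<omega>. \<omega> \<in> space M \<Longrightarrow> n k \<omega> \<le> b"
  shows "summable (\<lambda>k. measure M {\<omega> \<in> space M. n k \<omega> < n (Suc k) \<omega>})"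
proof (rule summableI_nonneg_bounded)
  interpret prob_space M by fact
  define I where "I k = {\<omega> \<in> space M. n k \<omega> < n (Suc k) \<omega>}" for k
  have I: "I k \<in> sets M" for k
    unfolding I_def by (intro nat_less_event meas)
  fix m
  have count: "(\<Sum>k<j. indicat_real (I k) \<omega>) \<le> real (n j \<omega>)" if "\<omega> \<in> space M" for j \<omega>
  proof (induction j)
    case (Suc j)
    then show ?case
      using mono[OF that, of j] that by (auto simp: I_def indicator_def)
  qed simp
  have int: "integrable M (indicat_real (I k))" for k
    using I by (simp add: integrable_indicator_iff emeasure_eq_measure)
  have "(\<Sum>k<m. measure M (I k)) = (\<integral>\<omega>. (\<Sum>k<m. indicat_real (I k) \<omega>) \<partial>M)"
    using int I by (subst Bochner_Integration.integral_sum) auto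
  also have "\<dots> \<le> real b"
  proof (intro integral_le_const AE_I2)
    show "(\<Sum>k<m. indicat_real (I k) \<omega>) \<le> real b" if "\<omega> \<in> space M" for \<omega>
      using count[OF that, of m] bound[OF that, of m] by linarith
  qed (use int in auto)
  finally show "(\<Sum>k<m. measure M {\<omega> \<in> space M. n k \<omega> < n (Suc k) \<omega>}) \<le> real b"
    by (simp add: I_def)
qed simp

section \<open>Almost sure stationarity of accumulation points\<close>

theorem theorem4p2:
  fixes M :: "'a measure"
    and F G :: "nat \<Rightarrow> 'a measure"
    and N :: nat and w :: "nat \<Rightarrow> real" and fi :: "nat \<Rightarrow> real^'n \<Rightarrow> real"
    and l u :: "'n::finite \<Rightarrow> ereal"
    and x0 :: "real^'n" and N0 :: nat
    and \<beta> c c1 C :: real and \<epsilon> :: "nat \<Rightarrow> real" and eps_bar :: real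
    and x :: "nat \<Rightarrow> 'a \<Rightarrow> real^'n"
    and Nk Dk :: "nat \<Rightarrow> 'a \<Rightarrow> nat"
    and Ns Ds :: "nat \<Rightarrow> 'a \<Rightarrow> nat list"
    and kt :: "'a \<Rightarrow> nat"
    and L f_low C_b :: real
    and f :: "real^'n \<Rightarrow> real" and S :: "(real^'n) set"
    and fN :: "nat \<Rightarrow> 'a \<Rightarrow> real^'n \<Rightarrow> real" and xbar :: "nat \<Rightarrow> 'a \<Rightarrow> real^'n"
    and rt :: "nat \<Rightarrow> 'a \<Rightarrow> nat list \<Rightarrow> real" and decr :: "nat \<Rightarrow> 'a \<Rightarrow> nat list \<Rightarrow> bool"
    and D_minus :: "nat \<Rightarrow> 'a \<Rightarrow> nat list set"
  \<comment> \<open>abbreviations\<close>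
  assumes f_eq: "\<And>y. f y = (\<Sum>i=1..N. w i * fi i y)"
    and S_eq: "S = box_set l u"
    and fN_eq: "\<And>k \<omega>. fN k \<omega> = (if Nk k \<omega> < N then sample_avg fi (Ns k \<omega>) else f)"
    and xbar_eq: "\<And>k \<omega>. xbar k \<omega> = line_search \<beta> c1 (\<epsilon> k) (fN k \<omega>) (x k \<omega>) (proj_dir S (fN k \<omega>) (x k \<omega>))"
    and rt_eq: "\<And>k \<omega> J. rt k \<omega> J = norm (box_indicator l u (fN k \<omega>) (x k \<omega>)
                            - box_indicator l u (sample_avg fi J) (x k \<omega>))"
    and decr_eq: "\<And>k \<omega> J. decr k \<omega> J \<longleftrightarrow> sample_avg fi J (xbar k \<omega>)
                  \<le> sample_avg fi J (x k \<omega>) - c * (norm (proj_dir S (sample_avg fi J) (x k \<omega>)))\<^sup>2 + C * \<epsilon> k"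
    and D_minus_eq: "\<And>k \<omega>. D_minus k \<omega> = {J. length J = Dk k \<omega> \<and> set J \<subseteq> {s \<in> {1..N}. w s > 0}
                              \<and> (rt k \<omega> J > 0 \<or> \<not> decr k \<omega> J)}"
  \<comment> \<open>problem\<close>
    and weights: "\<And>i. i \<in> {1..N} \<Longrightarrow> w i \<ge> 0" "(\<Sum>i=1..N. w i) = 1"
    and bounds: "\<And>i. l i \<noteq> \<infinity>" "\<And>i. u i \<noteq> -\<infinity>" "S \<noteq> {}"
    and diff: "\<And>i y. i \<in> {1..N} \<Longrightarrow> fi i differentiable (at y)"
    and C1: "\<And>i. i \<in> {1..N} \<Longrightarrow> continuous_on UNIV (grad (fi i))"
    and lips: "\<And>i. i \<in> {1..N} \<Longrightarrow> L-lipschitz_on UNIV (grad (fi i))"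
    and below: "\<And>i y. i \<in> {1..N} \<Longrightarrow> f_low \<le> fi i y"
  \<comment> \<open>input of the algorithm\<close>
    and input: "x0 \<in> S" "N0 \<in> {1..N}"
    and params: "\<beta> \<in> {0<..<1}" "c \<in> {0<..<1}" "c1 \<in> {0<..<1}" "C > 0"
    and eps: "\<And>k. \<epsilon> k > 0" "summable \<epsilon>" "(\<Sum>k. \<epsilon> k) \<le> eps_bar"
  \<comment> \<open>randomness: \<open>F k\<close> is the information available before drawing \<open>Ns k\<close>,
      \<open>G k\<close> the information available before drawing \<open>Ds k\<close>\<close>
    and prob: "prob_space M"
    and filtr: "\<And>k. subalgebra M (F k)" "\<And>k. subalgebra M (G k)"
      "\<And>k. subalgebra (G k) (F k)" "\<And>k. subalgebra (F (Suc k)) (G k)"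
    and adapted:
      "\<And>k. Nk k \<in> measurable (F k) (count_space UNIV)"
      "\<And>k. Ns k \<in> measurable (G k) (count_space UNIV)"
      "\<And>k. Dk k \<in> measurable (G k) (count_space UNIV)"
      "\<And>k. Ds k \<in> measurable (F (Suc k)) (count_space UNIV)"
    and drawN: "\<And>k. iid_draws M (F k) N w {\<omega> \<in> space M. Nk k \<omega> < N} (Nk k) (Ns k)"
    and drawD: "\<And>k. iid_draws M (G k) N w {\<omega> \<in> space M. Nk k \<omega> < N} (Dk k) (Ds k)"
    and sizeD: "\<And>k \<omega>. \<lbrakk>\<omega> \<in> space M; Nk k \<omega> < N\<rbrakk> \<Longrightarrow> Dk k \<omega> \<in> {1..N - 1}"
  \<comment> \<open>iterations of the algorithm\<close>
    and init: "\<And>\<omega>. \<omega> \<in> space M \<Longrightarrow> x 0 \<omega> = x0 \<and> Nk 0 \<omega> = N0"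
    and full: "\<And>k \<omega>. \<lbrakk>\<omega> \<in> space M; Nk k \<omega> = N\<rbrakk> \<Longrightarrow> x (Suc k) \<omega> = xbar k \<omega> \<and> Nk (Suc k) \<omega> = N"
    and size_update: "\<And>k \<omega>. \<lbrakk>\<omega> \<in> space M; Nk k \<omega> < N\<rbrakk> \<Longrightarrow>
        (if rt k \<omega> (Ds k \<omega>) = 0 \<and> decr k \<omega> (Ds k \<omega>) then Nk (Suc k) \<omega> = Nk k \<omega>
         else Nk (Suc k) \<omega> \<in> {Nk k \<omega> + 1..N})"
    and x_update: "\<And>k \<omega>. \<lbrakk>\<omega> \<in> space M; Nk k \<omega> < N\<rbrakk> \<Longrightarrow>
        x (Suc k) \<omega> = (if decr k \<omega> (Ds k \<omega>) then xbar k \<omega> else x k \<omega>)"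
  \<comment> \<open>the random index\<close>
    and kt_meas: "kt \<in> measurable M (count_space UNIV)"
    and kt_FS: "\<And>\<omega>. \<lbrakk>\<omega> \<in> space M; \<exists>k. Nk k \<omega> = N\<rbrakk> \<Longrightarrow> kt \<omega> = (LEAST k. Nk k \<omega> = N)"
    and kt_MB: "AE \<omega> in M. (\<forall>k. Nk k \<omega> < N) \<longrightarrow>
        (\<exists>k1. \<forall>k\<ge>k1. D_minus k \<omega> = {}) \<longrightarrow> (\<forall>k\<ge>kt \<omega>. D_minus k \<omega> = {})"
    and moment: "integrable M (\<lambda>\<omega>. \<bar>f (x (kt \<omega>) \<omega>)\<bar>)"
      "(\<integral>\<omega>. \<bar>f (x (kt \<omega>) \<omega>)\<bar> \<partial>M) \<le> C_b"
  shows "AE \<omega> in M. \<forall>z. (\<exists>r::nat \<Rightarrow> nat. strict_mono r \<and> (\<lambda>j. x (r j) \<omega>) \<longlonglongrightarrow> z)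
           \<longrightarrow> stationary_point f S z"
proof -
  interpret prob_space M by (rule prob)
  have "0 < N"
    using input by auto
  have f_sum: "f = (\<lambda>y. \<Sum>i\<in>{1..N}. w i * fi i y)"
    using f_eq by (simp add: fun_eq_iff)
  have S: "closed S" "convex S"
    by (simp_all add: S_eq closed_box_set convex_box_set)
  have w_le_1: "w s \<le> 1" if "s \<in> {1..N}" for s
    using member_le_sum[OF that, of w] weights by simp
  have gderiv_f: "GDERIV f y :> (\<Sum>i\<in>{1..N}. w i *\<^sub>R grad (fi i) y)" for y
    unfolding f_sum using diff by (intro GDERIV_weighted_sum) auto
  have diff_f: "f differentiable (at y)" for y
    using gderiv_f unfolding gderiv_def differentiable_def by blast
  have grad_f: "grad f y = (\<Sum>i\<in>{1..N}. w i *\<^sub>R grad (fi i) y)" for y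
    using gderiv_f by (rule grad_eqI)
  have lip_f: "L-lipschitz_on UNIV (grad f)"
  proof (rule lipschitz_onI)
    fix y y' :: "real^'n"
    have "norm (grad f y - grad f y') = norm (\<Sum>i\<in>{1..N}. w i *\<^sub>R (grad (fi i) y - grad (fi i) y'))"
      by (simp add: grad_f sum_subtractf scaleR_diff_right)
    also have "\<dots> \<le> (\<Sum>i\<in>{1..N}. w i * (L * dist y y'))"
    proof (rule sum_norm_le)
      fix i assume i: "i \<in> {1..N}"
      then show "norm (w i *\<^sub>R (grad (fi i) y - grad (fi i) y')) \<le> w i * (L * dist y y')"
        using lipschitz_onD[OF lips[OF i], of y y'] weights(1)[OF i]
        by (auto simp: dist_norm intro: mult_left_mono)
    qed
    also have "\<dots> = L * dist y y'"
      using weights(2) by (simp add: sum_distrib_right[symmetric])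
    finally show "dist (grad f y) (grad f y') \<le> L * dist y y'"
      by (simp add: dist_norm)
    show "0 \<le> L"
      using lips[of 1] \<open>0 < N\<close> by (auto intro: lipschitz_on_nonneg)
  qed
  have below_f: "f_low \<le> f y" for y
  proof -
    have "f_low = (\<Sum>i\<in>{1..N}. w i * f_low)"
      using weights(2) by (simp add: sum_distrib_right[symmetric])
    also have "\<dots> \<le> f y"
      unfolding f_sum using weights below by (intro sum_mono mult_left_mono) auto
    finally show ?thesis .
  qed

  have Nk_le: "Nk k \<omega> \<le> N" if "\<omega> \<in> space M" for k \<omega>
  proof (induction k)
    case 0
    then show ?case using init[OF that] input by simp
  next
    case (Suc k)
    then show ?case
      using full[OF that, of k] size_update[OF that, of k]
      by (cases "Nk k \<omega> = N") (auto split: if_splits)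
  qed
  have Nk_mono: "Nk k \<omega> \<le> Nk (Suc k) \<omega>" if "\<omega> \<in> space M" for k \<omega>
    using full[OF that, of k] size_update[OF that, of k] Nk_le[OF that, of k]
    by (cases "Nk k \<omega> = N") (auto split: if_splits)
  have x_in_S: "x k \<omega> \<in> S" if "\<omega> \<in> space M" for k \<omega>
  proof (induction k)
    case 0
    then show ?case using init[OF that] input by simp
  next
    case (Suc k)
    then have "xbar k \<omega> \<in> S"
      unfolding xbar_eq using S params by (intro line_search_in_convex) auto
    with Suc show ?case
      using full[OF that, of k] x_update[OF that, of k] Nk_le[OF that, of k]
      by (cases "Nk k \<omega> = N") (auto split: if_splits)
  qed

  have spaces: "space (F k) = space M" "space (G k) = space M" for k
    using filtr(1,2)[of k] by (simp_all add: subalgebra_def)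
  \<comment> \<open>The trial point and the decrease test as explicit functions of the iterate, the sample size
    and the two samples, which shows that \<open>x k\<close> depends on the discrete history only.\<close>
  define trial where "trial k v n I =
      (let h = if n < N then sample_avg fi I else f in line_search \<beta> c1 (\<epsilon> k) h v (proj_dir S h v))"
    for k v n I
  define accept where "accept k v n I J \<longleftrightarrow> sample_avg fi J (trial k v n I)
      \<le> sample_avg fi J v - c * (norm (proj_dir S (sample_avg fi J) v))\<^sup>2 + C * \<epsilon> k" for k v n I J
  have xbar_trial: "xbar k \<omega> = trial k (x k \<omega>) (Nk k \<omega>) (Ns k \<omega>)" for k \<omega>
    by (simp add: xbar_eq fN_eq trial_def Let_def)
  have decr_accept: "decr k \<omega> J \<longleftrightarrow> accept k (x k \<omega>) (Nk k \<omega>) (Ns k \<omega>) J" for k \<omega> J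
    by (simp add: decr_eq accept_def xbar_trial)
  have past_code: "factors_through_code (G k) (\<lambda>\<omega>. (x k \<omega>, Nk k \<omega>, Ns k \<omega>))"
    if "factors_through_code (F k) (x k)" for k
    using factors_through_code_mono[OF that filtr(3)]
      factors_through_code_mono[OF factors_through_code_countable[OF adapted(1)] filtr(3)]
    by (intro factors_through_code_Pair factors_through_code_countable[OF adapted(2)])
  have x_code: "factors_through_code (F k) (x k)" for k
  proof (induction k)
    case 0
    then show ?case
      using init by (intro factors_through_code_const[of _ _ x0]) (simp add: spaces)
  next
    case (Suc k)
    then have "factors_through_code (F (Suc k)) (\<lambda>\<omega>. ((x k \<omega>, Nk k \<omega>, Ns k \<omega>), Ds k \<omega>))"
      by (rule factors_through_code_Pair[OF factors_through_code_mono[OF past_code filtr(4)]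
            factors_through_code_countable[OF adapted(4)]])
    then show ?case
    proof (rule factors_through_code_map)
      fix \<omega> assume "\<omega> \<in> space (F (Suc k))"
      then have "\<omega> \<in> space M"
        by (simp add: spaces)
      then show "x (Suc k) \<omega> = (\<lambda>((v, n, I), J). if n < N \<and> \<not> accept k v n I J then v else trial k v n I)
          ((x k \<omega>, Nk k \<omega>, Ns k \<omega>), Ds k \<omega>)"
        using full[of \<omega> k] x_update[of \<omega> k] Nk_le[of \<omega> k]
        by (cases "Nk k \<omega> = N") (auto simp: xbar_trial decr_accept)
    qed
  qed

  \<comment> \<open>The events on which the constant sample \<open>(s, \<dots>, s)\<close>, if it were drawn, would force a larger
    sample.  They are determined before \<open>Ds k\<close> is drawn.\<close>
  define A where "A s k = {\<omega> \<in> space M. Nk k \<omega> < N \<and> \<not> decr k \<omega> (replicate (Dk k \<omega>) s)}" for s k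
  have A_sets: "A s k \<in> sets (G k)" for s k
  proof -
    have "factors_through_code (G k) (\<lambda>\<omega>. ((x k \<omega>, Nk k \<omega>, Ns k \<omega>), Dk k \<omega>))"
      by (intro factors_through_code_Pair past_code x_code factors_through_code_countable[OF adapted(3)])
    from factors_through_code_event[OF this,
        of "\<lambda>((v, n, I), d). n < N \<and> \<not> accept k v n I (replicate d s)"]
    show ?thesis
      by (simp add: A_def decr_accept spaces)
  qed
  have A_sets_M: "A s k \<in> sets M" for s k
    using A_sets filtr(2)[of k] by (auto simp: subalgebra_def)
  have Nk_meas: "Nk k \<in> measurable M (count_space UNIV)" for k
    using measurable_from_subalg[OF filtr(1) adapted(1)] .
  have eventually_accepted: "AE \<omega> in M. \<forall>\<^sub>F k in sequentially. \<omega> \<notin> A s k"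
    if s: "s \<in> {1..N}" "0 < w s" for s
  proof -
    have prob_le: "measure M (A s k) * w s ^ N \<le> measure M {\<omega> \<in> space M. Nk k \<omega> < Nk (Suc k) \<omega>}" for k
    proof -
      have "measure M (A s k) * w s ^ N
          \<le> measure M {\<omega> \<in> A s k. Ds k \<omega> = replicate (Dk k \<omega>) s}"
      proof (rule iid_draws_constant_sample[OF prob filtr(2) drawD A_sets])
        show "A s k \<subseteq> {\<omega> \<in> space M. Nk k \<omega> < N}"
          by (auto simp: A_def)
        show "Dk k \<omega> \<le> N" if "\<omega> \<in> {\<omega> \<in> space M. Nk k \<omega> < N}" for \<omega>
          using sizeD[of \<omega> k] that by auto
      qed (use s w_le_1 in auto)
      also have "\<dots> \<le> measure M {\<omega> \<in> space M. Nk k \<omega> < Nk (Suc k) \<omega>}"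
      proof (rule finite_measure_mono)
        show "{\<omega> \<in> A s k. Ds k \<omega> = replicate (Dk k \<omega>) s} \<subseteq> {\<omega> \<in> space M. Nk k \<omega> < Nk (Suc k) \<omega>}"
          using size_update[of _ k] by (fastforce simp: A_def split: if_splits)
        show "{\<omega> \<in> space M. Nk k \<omega> < Nk (Suc k) \<omega>} \<in> sets M"
          by (intro nat_less_event Nk_meas)
      qed
      finally show ?thesis .
    qed
    have "summable (\<lambda>k. measure M (A s k) * w s ^ N)"
    proof (rule summable_comparison_test')
      show "summable (\<lambda>k. measure M {\<omega> \<in> space M. Nk k \<omega> < Nk (Suc k) \<omega>})"
        using prob Nk_meas Nk_mono Nk_le by (rule summable_prob_counter_increases)
      show "norm (measure M (A s k) * w s ^ N) \<le> measure M {\<omega> \<in> space M. Nk k \<omega> < Nk (Suc k) \<omega>}"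
        if "0 \<le> k" for k
        using prob_le[of k] s(2) by (simp add: abs_mult)
    qed
    then have "summable (\<lambda>k. measure M (A s k))"
      using summable_cmult_iff[of "w s ^ N" "\<lambda>k. measure M (A s k)"] s(2) by (simp add: mult.commute)
    with A_sets_M have "AE \<omega> in M. \<forall>\<^sub>F k in sequentially. \<omega> \<in> space M - A s k"
      by (intro borel_cantelli_AE1) (simp_all add: emeasure_eq_measure)
    then show ?thesis
    proof eventually_elim
      case (elim \<omega>)
      then show ?case
        by (rule eventually_mono) simp
    qed
  qed
  then have "AE \<omega> in M. \<forall>s\<in>{1..N}. 0 < w s \<longrightarrow> (\<forall>\<^sub>F k in sequentially. \<omega> \<notin> A s k)"
    by (intro AE_finite_allI) auto

  then show ?thesis
  proof (rule AE_mp, intro AE_I2 impI allI, elim exE conjE)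
    fix \<omega> z and r :: "nat \<Rightarrow> nat"
    assume \<omega>: "\<omega> \<in> space M"
      and acc: "\<forall>s\<in>{1..N}. 0 < w s \<longrightarrow> (\<forall>\<^sub>F k in sequentially. \<omega> \<notin> A s k)"
      and r: "strict_mono r" "(\<lambda>j. x (r j) \<omega>) \<longlonglongrightarrow> z"
    have "z \<in> S"
      using closed_sequentially[OF S(1) _ r(2)] x_in_S[OF \<omega>] by blast
    show "stationary_point f S z"
    proof (cases "\<exists>K. Nk K \<omega> = N")
      case True
      then obtain K where K: "Nk K \<omega> = N" ..
      have NkN: "Nk k \<omega> = N" if "K \<le> k" for k
        using that
      proof (induction k rule: dec_induct)
        case base
        show ?case by (rule K)
      next
        case (step k)
        then show ?case using full[OF \<omega>] by blast
      qed
      have "(\<lambda>k. proj_dir S f (x k \<omega>)) \<longlonglongrightarrow> 0"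
      proof (rule line_search_proj_dir_tendsto_0[OF diff_f lip_f S])
        show "x (Suc k) \<omega> = line_search \<beta> c1 (\<epsilon> k) f (x k \<omega>) (proj_dir S f (x k \<omega>))"
          if "K \<le> k" for k
          using full[OF \<omega> NkN[OF that]] NkN[OF that] by (simp add: xbar_eq fN_eq)
      qed (use params eps below_f x_in_S[OF \<omega>] in auto)
      then show ?thesis
        by (rule stationary_accumulation_point[OF S bounds(3) lipschitz_on_continuous_on[OF lip_f] _ r])
    next
      case False
      then have Nk_less: "Nk k \<omega> < N" for k
        using Nk_le[OF \<omega>, of k] by (metis le_neq_implies_less)
      have "finite (range (\<lambda>k. Nk k \<omega>))"
        using Nk_le[OF \<omega>] by (auto intro: finite_subset[OF _ finite_atMost[of N]])
      then have "Max (range (\<lambda>k. Nk k \<omega>)) \<in> range (\<lambda>k. Nk k \<omega>)"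
        by (intro Max_in) auto
      then obtain K where K: "Nk K \<omega> = Max (range (\<lambda>k. Nk k \<omega>))"
        by auto
      have Nk_max: "Nk k \<omega> \<le> Nk K \<omega>" for k
        unfolding K using \<open>finite _\<close> by (intro Max_ge) auto
      have Nk_const: "Nk k \<omega> = Nk K \<omega>" if "K \<le> k" for k
        using lift_Suc_mono_le[of "\<lambda>k. Nk k \<omega>", OF Nk_mono[OF \<omega>] that] Nk_max[of k] by simp
      \<comment> \<open>A rejected trial point would have increased the sample size.\<close>
      have x_xbar: "x (Suc k) \<omega> = xbar k \<omega>" if "K \<le> k" for k
        using Nk_const[of k] Nk_const[of "Suc k"] that x_update[OF \<omega> Nk_less, of k]
          size_update[OF \<omega> Nk_less, of k]
        by (auto split: if_splits)
      have "stationary_point (fi s) S z" if s: "s \<in> {1..N}" "0 < w s" for s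
      proof -
        obtain K' where K': "\<omega> \<notin> A s k" if "K' \<le> k" for k
          using acc s unfolding eventually_sequentially by blast
        have "(\<lambda>k. proj_dir S (fi s) (x k \<omega>)) \<longlonglongrightarrow> 0"
        proof (rule sufficient_decrease_tendsto_0[where a = "\<lambda>k. fi s (x k \<omega>)"
              and e = "\<lambda>k. C * \<epsilon> k" and K = "max K K'" and B = f_low and \<kappa> = c])
          fix k assume k: "max K K' \<le> k"
          then have "decr k \<omega> (replicate (Dk k \<omega>) s)"
            using K'[of k] Nk_less \<omega> by (auto simp: A_def)
          moreover have "0 < Dk k \<omega>"
            using sizeD[OF \<omega> Nk_less, of k] by simp
          ultimately show "fi s (x (Suc k) \<omega>)
              \<le> fi s (x k \<omega>) - c * (norm (proj_dir S (fi s) (x k \<omega>)))\<^sup>2 + C * \<epsilon> k"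
            using k by (simp add: decr_eq sample_avg_replicate x_xbar)
        qed (use params eps below s in \<open>auto intro: less_imp_le summable_mult\<close>)
        then show ?thesis
          by (rule stationary_accumulation_point[OF S bounds(3) C1[OF s(1)] _ r])
      qed
      then show ?thesis
        unfolding f_sum using diff weights(1) \<open>z \<in> S\<close>
        by (intro stationary_point_weighted_sum) auto
    qed
  qed
qed

end
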